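(* Let $\Gamma$ be a finite two-player game with partial monitoring that has a semi-standard information structure, let $\{x_\ell;\ \ell\in\mathcal{L}\}\subset\mathcal{X}$ and $\{y_k;\ k\in\mathcal{K}\}\subset\mathcal{Y}$ be the two finite sets of mixed actions associated with $\Gamma$ in the context, and let $\widetilde{\Gamma}$ be the auxiliary finite game with full monitoring, with action sets $\mathcal{L}$ (player 1) and $\mathcal{K}$ (player 2) and payoffs $$\widetilde{u}(\ell,k)=\min_{U\in\Phi(y_k)}\langle x_\ell,U\rangle,\qquad \widetilde{v}(\ell,k)=\min_{V\in\Psi(x_\ell)}\langle y_k,V\rangle .$$ Then every Nash equilibrium $(\mathbf{x},\mathbf{y})\in\Delta(\mathcal{L})\times\Delta(\mathcal{K})$ of $\widetilde{\Gamma}$ induces a Nash equilibrium of $\Gamma$, namely $\left(\sum_{\ell\in\mathcal{L}}\mathbf{x}[\ell]x_\ell,\ \sum_{k\in\mathcal{K}}\mathbf{y}[k]y_k\right)$; and, reciprocally, every Nash equilibrium of $\Gamma$ is induced in this way by a Nash equilibrium of $\widetilde{\Gamma}$.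
   Context: Game with partial monitoring: $\mathcal{A},\mathcal{B}$ are the finite action sets of players 1 and 2, of cardinalities $A$ and $B$; $\mathcal{X}=\Delta(\mathcal{A})$, $\mathcal{Y}=\Delta(\mathcal{B})$ are the sets of mixed actions (probability vectors); $u,v:\mathcal{A}\times\mathcal{B}\to\mathbb{R}$ are the payoffs of players 1 and 2, extended multilinearly to $\mathcal{X}\times\mathcal{Y}$. There are convex compact sets of messages $\mathcal{H},\mathcal{M}$ (in real vector spaces) and signaling maps $H:\mathcal{A}\times\mathcal{B}\to\mathcal{H}$, $M:\mathcal{A}\times\mathcal{B}\to\mathcal{M}$, also extended multilinearly. Put $\mathbf{H}(y)=[H(a,y)]_{a\in\mathcal{A}}\in\mathcal{H}^A$ for $y\in\mathcal{Y}$, $\mathbf{M}(x)=[M(x,b)]_{b\in\mathcal{B}}\in\mathcal{M}^B$ for $x\in\mathcal{X}$, and $$\Phi(y)=\{u(\cdot,y')\in\mathbb{R}^A:\ y'\in\mathcal{Y},\ \mathbf{H}(y')=\mathbf{H}(y)\},\qquad \Psi(x)=\{v(x',\cdot)\in\mathbb{R}^B:\ x'\in\mathcal{X},\ \mathbf{M}(x')=\mathbf{M}(x)\}.$$ These sets are polytopes. Nash equilibrium of $\Gamma$: a pair $(x^*,y^* )\in\mathcal{X}\times\mathcal{Y}$ with $x^*\in\arg\max_{x\in\mathcal{X}}\inf_{U\in\Phi(y^* )}\langle x,U\rangle$ and $y^*\in\arg\max_{y\in\mathcal{Y}}\inf_{V\in\Psi(x^* )}\langle y,V\rangle$. Semi-standard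 structure: the information of player 1 is semi-standard if there is a partition $\{\mathcal{B}_i;\ i\in\mathcal{I}\}$ of $\mathcal{B}$ such that (i) if $b,b'$ belong to the same cell $\mathcal{B}_i$ then $\mathbf{H}(b)=\mathbf{H}(b')=:\mathbf{H}_i$; and (ii) the family $\{\mathbf{H}_i;\ i\in\mathcal{I}\}$ is linearly independent, i.e. $\sum_i\lambda_i\mathbf{H}_i=\sum_i\gamma_i\mathbf{H}_i$ implies $\lambda_i=\gamma_i$ for every $i$. Similarly for player 2, with $\mathbf{M}$ and a partition of $\mathcal{A}$. The game has a semi-standard structure if this holds for both players. The sets $\{x_\ell\}$ and $\{y_k\}$: for $y\in\mathcal{Y}$ and a vertex $U^\sharp$ of $\Phi(y)$, let $N_y(U^\sharp)=\{z\in\mathbb{R}^A:\ \langle z,U-U^\sharp\rangle\le 0\ \ \forall\, U\in\Phi(y)\}$ be the normal cone to $\Phi(y)$ at $U^\sharp$. Then $\{x_\ell;\ \ell\in\mathcal{L}\}$ is the set of all $x\in\mathcal{X}$ such that $-x$ is a vertex of the polytope $(-\mathcal{X})\cap N_y(U^\sharp)$ for some $y\in\mathcal{Y}$ and some vertex $U^\sharp$ of $\Phi(y)$. This set is finite; for every $y\in\mathcal{Y}$ it contains a maximizer of $x\mapsto\min_{U\in\Phi(y)}\langle x,U\rangle$ over $\mathcal{X}$, and its convex hull contains the whole set of maximizers. The set $\{y_k;\ k\in\mathcal{K}\}\subset\mathcal{Y}$ is defined in the dual way for player 2, from $\Psi$ and $-\mathcal{Y}$. Nash equilibria of $\widetilde{\Gamma}$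 are the usual mixed Nash equilibria, with $\widetilde{u},\widetilde{v}$ extended multilinearly to $\Delta(\mathcal{L})\times\Delta(\mathcal{K})$. *)

theory Defs
  imports "HOL-Analysis.Analysis"
begin

definition mixed_actions :: "(real ^ 'n) set" where
  "mixed_actions = {x. (\<forall>i. 0 \<le> x $ i) \<and> (\<Sum>i\<in>UNIV. x $ i) = 1}"

text \<open>
  One-sided notions are written from the point of view of player 1: the first index of a payoff or
  signaling map is the player's own action, the second one the opponent's. The notions of player 2
  are obtained by exchanging the two arguments with \<open>swap_args\<close>.
\<close>

definition swap_args :: "('a \<Rightarrow> 'b \<Rightarrow> 'c) \<Rightarrow> 'b \<Rightarrow> 'a \<Rightarrow> 'c" where
  "swap_args f = (\<lambda>b a. f a b)"

definition payoff_vec :: "('a::finite \<Rightarrow> 'b::finite \<Rightarrow> real) \<Rightarrow> real ^ 'b \<Rightarrow> real ^ 'a" where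
  "payoff_vec u y = (\<chi> a. \<Sum>b\<in>UNIV. y $ b * u a b)"

definition signal_vec ::
    "('a::finite \<Rightarrow> 'b::finite \<Rightarrow> 'h::real_vector) \<Rightarrow> real ^ 'b \<Rightarrow> 'h ^ 'a" where
  "signal_vec H y = (\<chi> a. \<Sum>b\<in>UNIV. y $ b *\<^sub>R H a b)"

text \<open>
  The set \<open>\<Phi>(y)\<close>; the set \<open>\<Psi>(x)\<close> is
  \<open>compatible_payoffs (swap_args v) (swap_args M) x\<close>.
\<close>

definition compatible_payoffs ::
    "('a::finite \<Rightarrow> 'b::finite \<Rightarrow> real) \<Rightarrow> ('a \<Rightarrow> 'b \<Rightarrow> 'h::real_vector)
      \<Rightarrow> real ^ 'b \<Rightarrow> (real ^ 'a) set" where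
  "compatible_payoffs u H y =
     {payoff_vec u y' | y'. y' \<in> mixed_actions \<and> signal_vec H y' = signal_vec H y}"

text \<open>
  For a mixed action \<open>y\<close> this infimum is a minimum, see \<open>worst_payoff_attained\<close> below.
\<close>

definition worst_payoff ::
    "('a::finite \<Rightarrow> 'b::finite \<Rightarrow> real) \<Rightarrow> ('a \<Rightarrow> 'b \<Rightarrow> 'h::real_vector)
      \<Rightarrow> real ^ 'a \<Rightarrow> real ^ 'b \<Rightarrow> real" where
  "worst_payoff u H x y = (INF U\<in>compatible_payoffs u H y. x \<bullet> U)"

definition pm_nash ::
    "('a::finite \<Rightarrow> 'b::finite \<Rightarrow> real) \<Rightarrow> ('a \<Rightarrow> 'b \<Rightarrow> real)
      \<Rightarrow> ('a \<Rightarrow> 'b \<Rightarrow> 'h::real_vector) \<Rightarrow> ('a \<Rightarrow> 'b \<Rightarrow> 'm::real_vector)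
      \<Rightarrow> real ^ 'a \<Rightarrow> real ^ 'b \<Rightarrow> bool" where
  "pm_nash u v H M x y \<longleftrightarrow>
     is_arg_max (\<lambda>x'. worst_payoff u H x' y) (\<lambda>x'. x' \<in> mixed_actions) x \<and>
     is_arg_max (\<lambda>y'. worst_payoff (swap_args v) (swap_args M) y' x)
       (\<lambda>y'. y' \<in> mixed_actions) y"

text \<open>The pure action \<open>b\<close> is the mixed action \<open>axis b 1\<close>.\<close>

definition semi_standard :: "('a::finite \<Rightarrow> 'b::finite \<Rightarrow> 'h::real_vector) \<Rightarrow> bool" where
  "semi_standard H \<longleftrightarrow>
     (\<exists>(P :: 'b set set) (h :: 'b set \<Rightarrow> 'h ^ 'a).
        partition_on UNIV P \<and>
        (\<forall>C\<in>P. \<forall>b\<in>C. signal_vec H (axis b 1) = h C) \<and>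
        (\<forall>\<alpha> \<gamma> :: 'b set \<Rightarrow> real.
           (\<Sum>C\<in>P. \<alpha> C *\<^sub>R h C) = (\<Sum>C\<in>P. \<gamma> C *\<^sub>R h C) \<longrightarrow> (\<forall>C\<in>P. \<alpha> C = \<gamma> C)))"

definition normal_cone :: "'v::real_inner set \<Rightarrow> 'v \<Rightarrow> 'v set" where
  "normal_cone P U = {z. \<forall>W\<in>P. z \<bullet> (W - U) \<le> 0}"

text \<open>The set \<open>{x\<^sub>\<ell>}\<close>; the set \<open>{y\<^sub>k}\<close> is \<open>key_actions (swap_args v) (swap_args M)\<close>.\<close>

definition key_actions ::
    "('a::finite \<Rightarrow> 'b::finite \<Rightarrow> real) \<Rightarrow> ('a \<Rightarrow> 'b \<Rightarrow> 'h::real_vector)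
      \<Rightarrow> (real ^ 'a) set" where
  "key_actions u H =
     {x \<in> mixed_actions. \<exists>y\<in>mixed_actions. \<exists>U.
        U extreme_point_of compatible_payoffs u H y \<and>
        (- x) extreme_point_of (uminus ` mixed_actions \<inter> normal_cone (compatible_payoffs u H y) U)}"

text \<open>
  Finite games with full monitoring whose action sets \<open>S\<close> and \<open>T\<close> are arbitrary finite sets; the
  values of a distribution outside its action set are irrelevant.
\<close>

definition distributions_on :: "'s set \<Rightarrow> ('s \<Rightarrow> real) set" where
  "distributions_on S = {p. (\<forall>s\<in>S. 0 \<le> p s) \<and> sum p S = 1}"

definition expected_payoff ::
    "'s set \<Rightarrow> 't set \<Rightarrow> ('s \<Rightarrow> 't \<Rightarrow> real) \<Rightarrow> ('s \<Rightarrow> real) \<Rightarrow> ('t \<Rightarrow> real) \<Rightarrow> real" where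
  "expected_payoff S T f p q = (\<Sum>s\<in>S. \<Sum>t\<in>T. p s * q t * f s t)"

definition mixed_nash ::
    "'s set \<Rightarrow> 't set \<Rightarrow> ('s \<Rightarrow> 't \<Rightarrow> real) \<Rightarrow> ('s \<Rightarrow> 't \<Rightarrow> real)
      \<Rightarrow> ('s \<Rightarrow> real) \<Rightarrow> ('t \<Rightarrow> real) \<Rightarrow> bool" where
  "mixed_nash S T f g p q \<longleftrightarrow>
     is_arg_max (\<lambda>p'. expected_payoff S T f p' q) (\<lambda>p'. p' \<in> distributions_on S) p \<and>
     is_arg_max (\<lambda>q'. expected_payoff S T g p q') (\<lambda>q'. q' \<in> distributions_on T) q"

text \<open>
  The auxiliary game; its action sets are the sets \<open>{x\<^sub>\<ell>}\<close> and \<open>{y\<^sub>k}\<close> themselves.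
\<close>

definition aux_nash ::
    "('a::finite \<Rightarrow> 'b::finite \<Rightarrow> real) \<Rightarrow> ('a \<Rightarrow> 'b \<Rightarrow> real)
      \<Rightarrow> ('a \<Rightarrow> 'b \<Rightarrow> 'h::real_vector) \<Rightarrow> ('a \<Rightarrow> 'b \<Rightarrow> 'm::real_vector)
      \<Rightarrow> (real ^ 'a \<Rightarrow> real) \<Rightarrow> (real ^ 'b \<Rightarrow> real) \<Rightarrow> bool" where
  "aux_nash u v H M p q \<longleftrightarrow>
     mixed_nash (key_actions u H) (key_actions (swap_args v) (swap_args M))
       (\<lambda>x y. worst_payoff u H x y)
       (\<lambda>x y. worst_payoff (swap_args v) (swap_args M) y x) p q"

lemma compact_mixed_actions: "compact (mixed_actions :: (real ^ 'n) set)"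
proof -
  have eq: "(mixed_actions :: (real ^ 'n) set) =
      (\<Inter>i. {x. 0 \<le> x $ i}) \<inter> {x. (\<Sum>i\<in>UNIV. x $ i) = 1}"
    by (auto simp: mixed_actions_def)
  have "closed (mixed_actions :: (real ^ 'n) set)"
    unfolding eq
    by (intro closed_Int closed_INT ballI closed_Collect_le closed_Collect_eq continuous_intros)
  moreover have "bounded (mixed_actions :: (real ^ 'n) set)"
    unfolding bounded_iff
  proof (intro exI ballI)
    fix x :: "real ^ 'n" assume "x \<in> mixed_actions"
    then show "norm x \<le> 1"
      using norm_le_l1_cart[of x] by (simp add: mixed_actions_def)
  qed
  ultimately show ?thesis by (simp add: compact_eq_bounded_closed)
qed

lemma compact_compatible_payoffs: "compact (compatible_payoffs u H y)"
proof -
  let ?S = "{y'. signal_vec H y' = signal_vec H y}"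
  have lin: "linear (signal_vec H)"
    by (rule linearI)
      (simp_all add: signal_vec_def vec_eq_iff scaleR_left_distrib sum.distrib scaleR_sum_right)
  have "affine ?S"
    by (simp add: affine_def linear_add[OF lin] linear_scale[OF lin]
        flip: scaleR_left_distrib)
  then have "compact (mixed_actions \<inter> ?S)"
    using compact_Int_closed[OF compact_mixed_actions] closed_affine_hull[of ?S]
    by (simp only: affine_hull_eq[THEN iffD2])
  moreover have "continuous_on (mixed_actions \<inter> ?S) (payoff_vec u)"
    unfolding payoff_vec_def by (intro continuous_intros)
  moreover have "compatible_payoffs u H y = payoff_vec u ` (mixed_actions \<inter> ?S)"
    by (auto simp: compatible_payoffs_def)
  ultimately show ?thesis by (simp add: compact_continuous_image)
qed

lemma worst_payoff_attained:
  assumes "y \<in> mixed_actions"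
  shows "\<exists>U\<in>compatible_payoffs u H y. worst_payoff u H x y = x \<bullet> U \<and>
           (\<forall>W\<in>compatible_payoffs u H y. x \<bullet> U \<le> x \<bullet> W)"
proof -
  have "compatible_payoffs u H y \<noteq> {}"
    using assms by (auto simp: compatible_payoffs_def)
  then obtain U where U: "U \<in> compatible_payoffs u H y"
      "\<forall>W\<in>compatible_payoffs u H y. x \<bullet> U \<le> x \<bullet> W"
    using continuous_attains_inf[OF compact_compatible_payoffs, of u H y "\<lambda>W. x \<bullet> W"]
    using continuous_on_inner[OF continuous_on_const continuous_on_id] by blast
  then have "worst_payoff u H x y = x \<bullet> U"
    unfolding worst_payoff_def by (intro cInf_eq_minimum) auto
  with U show ?thesis by blast
qed

end

theory Submission imports Defs begin

text \<open>
  Semi-standardness makes the worst payoff linear in the opponent's mixed action, because each unit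
  of mass may be moved freely within its cell and cannot leave it; it is always concave in the
  player's own action. Moreover, given the opponent's action \<open>y\<close>, every mixed action is an average
  of key actions along which the worst payoff against \<open>y\<close> is affine: decompose it inside the normal
  cone of a vertex \<open>U\<close> at which its own worst payoff is attained. These two facts transport best
  responses between the two games. Finiteness of the set of key actions holds because a normal cone
  depends only on the support of a mixed action that induces its vertex.
\<close>

section \<open>Payoff and signal vectors\<close>

lemma linear_payoff_vec: "linear (payoff_vec u)"
  by (rule linearI)
    (simp_all add: payoff_vec_def vec_eq_iff algebra_simps sum.distrib sum_distrib_left)

lemma linear_signal_vec: "linear (signal_vec H)"
  by (rule linearI)
    (simp_all add: signal_vec_def vec_eq_iff scaleR_left_distrib sum.distrib scaleR_sum_right)

lemma vec_eq_sum_axis: "y = (\<Sum>b\<in>UNIV. y $ b *\<^sub>R axis b (1::real))"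
  by (simp add: vec_eq_iff axis_def if_distrib cong: if_cong)

lemma linear_eq_sum_axis:
  assumes "linear f"
  shows "f y = (\<Sum>b\<in>UNIV. y $ b *\<^sub>R f (axis b (1::real)))"
proof -
  have "f y = f (\<Sum>b\<in>UNIV. y $ b *\<^sub>R axis b 1)"
    by (rule arg_cong[OF vec_eq_sum_axis])
  then show ?thesis
    by (simp only: linear_sum[OF assms] linear_scale[OF assms])
qed

lemma inner_payoff_vec: "x \<bullet> payoff_vec u y = (\<Sum>b\<in>UNIV. y $ b * (x \<bullet> payoff_vec u (axis b 1)))"
  by (subst linear_eq_sum_axis[OF linear_payoff_vec, of u y]) (simp add: inner_sum_right)

lemma axis_mixed_actions: "axis b 1 \<in> mixed_actions"
  by (simp add: mixed_actions_def axis_def)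

lemma convex_mixed_actions: "convex mixed_actions"
  unfolding convex_def mixed_actions_def
  by (auto simp: sum.distrib simp flip: sum_distrib_left)

lemma mixed_actions_sum:
  assumes "\<And>i. i \<in> I \<Longrightarrow> 0 \<le> p i" "sum p I = 1" "\<And>i. i \<in> I \<Longrightarrow> f i \<in> mixed_actions"
  shows "(\<Sum>i\<in>I. p i *\<^sub>R f i) \<in> mixed_actions"
proof -
  \<comment> \<open>A sum over an infinite set is 0 by convention, so total weight 1 forces
    \<open>I\<close> to be finite.\<close>
  have "finite I"
    using assms(2) by (metis sum.infinite zero_neq_one)
  then show ?thesis
    using convex_sum[OF _ convex_mixed_actions] assms by blast
qed

lemma convex_compatible_payoffs: "convex (compatible_payoffs u H y)"
proof -
  have "convex (signal_vec H -` {signal_vec H y})"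
    by (rule convex_linear_vimage[OF linear_signal_vec]) simp
  then have "convex (payoff_vec u ` (mixed_actions \<inter> signal_vec H -` {signal_vec H y}))"
    by (intro convex_linear_image[OF linear_payoff_vec] convex_Int convex_mixed_actions)
  moreover have "compatible_payoffs u H y =
      payoff_vec u ` (mixed_actions \<inter> signal_vec H -` {signal_vec H y})"
    by (auto simp: compatible_payoffs_def)
  ultimately show ?thesis by simp
qed

text \<open>The cell signals are linearly independent, so a signal determines the mass of every
  cell, and with it the weighted sum of a function constant on cells. Asking \<open>\<mu>\<close> to
  be constant on actions of equal signal keeps the partition out of the statement.\<close>

lemma semi_standard_sum_eq:
  fixes H :: "'a::finite \<Rightarrow> 'b::finite \<Rightarrow> 'h::real_vector" and \<mu> :: "'b \<Rightarrow> real"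
  assumes "semi_standard H" "signal_vec H y' = signal_vec H y"
    and \<mu>: "\<And>b b'. signal_vec H (axis b 1) = signal_vec H (axis b' 1) \<Longrightarrow> \<mu> b = \<mu> b'"
  shows "(\<Sum>b\<in>UNIV. y' $ b * \<mu> b) = (\<Sum>b\<in>UNIV. y $ b * \<mu> b)"
proof -
  obtain P :: "'b set set" and h :: "'b set \<Rightarrow> 'h ^ 'a" where
    P: "partition_on UNIV P" and h: "\<forall>C\<in>P. \<forall>b\<in>C. signal_vec H (axis b 1) = h C"
    and ind: "\<forall>\<alpha> \<gamma> :: 'b set \<Rightarrow> real.
      (\<Sum>C\<in>P. \<alpha> C *\<^sub>R h C) = (\<Sum>C\<in>P. \<gamma> C *\<^sub>R h C) \<longrightarrow> (\<forall>C\<in>P. \<alpha> C = \<gamma> C)"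
    using assms(1) unfolding semi_standard_def by (elim exE conjE) (rule that)
  have cells: "sum f UNIV = (\<Sum>C\<in>P. sum f C)" for f :: "'b \<Rightarrow> 'c::comm_monoid_add"
    using sum.Union_disjoint[of P f] P
    by (auto simp: partition_on_def disjoint_def)
  have signal: "signal_vec H z = (\<Sum>C\<in>P. (\<Sum>b\<in>C. z $ b) *\<^sub>R h C)" for z
    unfolding linear_eq_sum_axis[OF linear_signal_vec, of H z] cells scaleR_sum_left
    using h by (intro sum.cong) auto
  \<comment> \<open>By \<open>signal\<close>, both sides expand in the family \<open>h\<close> with
    the cell masses as coefficients; independence equates them.\<close>
  have mass: "(\<Sum>b\<in>C. y' $ b) = (\<Sum>b\<in>C. y $ b)" if "C \<in> P" for C
    using ind[rule_format, of "\<lambda>C. \<Sum>b\<in>C. y' $ b" "\<lambda>C. \<Sum>b\<in>C. y $ b"] assms(2) that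
    by (simp add: signal)
  have "(\<Sum>b\<in>C. y' $ b * \<mu> b) = (\<Sum>b\<in>C. y $ b * \<mu> b)" if C: "C \<in> P" for C
  proof -
    have "\<mu> b = \<mu> b'" if "b \<in> C" "b' \<in> C" for b b'
      using h C that by (intro \<mu>) simp
    then obtain m where "\<And>b. b \<in> C \<Longrightarrow> \<mu> b = m"
      by metis
    then show ?thesis
      using mass[OF C] by (simp flip: sum_distrib_right)
  qed
  then show ?thesis
    unfolding cells by simp
qed

section \<open>The worst payoff\<close>

text \<open>The most harmful mixed action compatible with the signal of \<open>y\<close> moves the
  mass of each \<open>b\<close> to an action of equal signal that is worst for \<open>x\<close>. The
  resulting value is linear in \<open>y\<close>; \<open>w\<close> depends on \<open>x\<close>
  only.\<close>

lemma worst_payoff_linear: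
  fixes u :: "'a::finite \<Rightarrow> 'b::finite \<Rightarrow> real"
  assumes H: "semi_standard H"
  obtains w where "\<And>y. y \<in> mixed_actions \<Longrightarrow> worst_payoff u H x y = (\<Sum>b\<in>UNIV. y $ b * w b)"
proof -
  define s where "s b = signal_vec H (axis b 1)" for b
  define c where "c b = x \<bullet> payoff_vec u (axis b 1)" for b
  define r where "r b = (SOME b'. is_arg_min c (\<lambda>b'. s b' = s b) b')" for b
  have r_min: "is_arg_min c (\<lambda>b'. s b' = s b) (r b)" for b
  proof -
    obtain b' where "is_arg_min c (\<lambda>b'. b' \<in> {b'. s b' = s b}) b'"
      using ex_is_arg_min_if_finite[of "{b'. s b' = s b}" c] by auto
    then show ?thesis
      unfolding r_def by (intro someI) simp
  qed
  have r: "s (r b) = s b" and r_le: "s b' = s b \<Longrightarrow> c (r b) \<le> c b'" for b b'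
    using r_min[of b] by (auto simp: is_arg_min_linorder)
  have r_cong: "c (r b) = c (r b')" if "s b = s b'" for b b'
    using r_le[of "r b'" b] r_le[of "r b" b'] r that by force
  have "worst_payoff u H x y = (\<Sum>b\<in>UNIV. y $ b * c (r b))" if y: "y \<in> mixed_actions" for y
    unfolding worst_payoff_def
  proof (rule cInf_eq_minimum)
    \<comment> \<open>All mass of \<open>b\<close> goes to \<open>r b\<close>; summing axis vectors
      lets several actions send their mass to the same target.\<close>
    define y' where "y' = (\<Sum>b\<in>UNIV. y $ b *\<^sub>R axis (r b) (1::real))"
    have "y' \<in> mixed_actions"
      unfolding y'_def using y
      by (intro mixed_actions_sum axis_mixed_actions) (auto simp: mixed_actions_def)
    moreover have "signal_vec H y' = (\<Sum>b\<in>UNIV. y $ b *\<^sub>R s (r b))"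
      by (simp add: y'_def s_def linear_sum[OF linear_signal_vec] linear_scale[OF linear_signal_vec])
    then have "signal_vec H y' = signal_vec H y"
      by (simp add: r linear_eq_sum_axis[OF linear_signal_vec, of H y] flip: s_def)
    moreover have "x \<bullet> payoff_vec u y' = (\<Sum>b\<in>UNIV. y $ b * c (r b))"
      by (simp add: y'_def c_def linear_sum[OF linear_payoff_vec] linear_scale[OF linear_payoff_vec]
          inner_sum_right)
    ultimately show "(\<Sum>b\<in>UNIV. y $ b * c (r b)) \<in> (\<bullet>) x ` compatible_payoffs u H y"
      unfolding compatible_payoffs_def by force
  next
    fix t assume "t \<in> (\<bullet>) x ` compatible_payoffs u H y"
    then obtain y' where y': "y' \<in> mixed_actions" "signal_vec H y' = signal_vec H y"
      and t: "t = x \<bullet> payoff_vec u y'"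
      by (auto simp: compatible_payoffs_def)
    \<comment> \<open>\<open>c (r b)\<close> depends only on the signal of \<open>b\<close>, so
      every compatible \<open>y'\<close> gives it the same mean; pointwise it is at most
      \<open>c b\<close>.\<close>
    have "(\<Sum>b\<in>UNIV. y $ b * c (r b)) = (\<Sum>b\<in>UNIV. y' $ b * c (r b))"
      by (rule semi_standard_sum_eq[OF H y'(2), symmetric], rule r_cong) (simp add: s_def)
    also have "\<dots> \<le> (\<Sum>b\<in>UNIV. y' $ b * c b)"
      using y'(1) by (intro sum_mono mult_left_mono r_le) (auto simp: mixed_actions_def)
    also have "\<dots> = t"
      unfolding t c_def by (rule inner_payoff_vec[symmetric])
    finally show "(\<Sum>b\<in>UNIV. y $ b * c (r b)) \<le> t" .
  qed
  then show thesis by (rule that)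
qed

text \<open>One family of coefficients \<open>w\<close> serves every point of \<open>T\<close> and
  their average alike. This identifies expected payoffs of the auxiliary game with worst payoffs
  against an averaged opponent.\<close>

lemma worst_payoff_sum_right:
  assumes "semi_standard H" "T \<subseteq> mixed_actions" "q \<in> distributions_on T"
  shows "worst_payoff u H x (\<Sum>y\<in>T. q y *\<^sub>R y) = (\<Sum>y\<in>T. q y * worst_payoff u H x y)"
proof -
  obtain w where w: "\<And>y. y \<in> mixed_actions \<Longrightarrow> worst_payoff u H x y = (\<Sum>b\<in>UNIV. y $ b * w b)"
    using worst_payoff_linear[OF assms(1)] by metis
  have "(\<Sum>y\<in>T. q y *\<^sub>R y) \<in> mixed_actions"
    using assms(2,3) by (intro mixed_actions_sum) (auto simp: distributions_on_def)
  then have "worst_payoff u H x (\<Sum>y\<in>T. q y *\<^sub>R y) = (\<Sum>b\<in>UNIV. \<Sum>y\<in>T. q y * (y $ b * w b))"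
    by (simp add: w sum_distrib_right mult.assoc)
  also have "\<dots> = (\<Sum>y\<in>T. q y * (\<Sum>b\<in>UNIV. y $ b * w b))"
    by (subst sum.swap) (simp add: sum_distrib_left)
  also have "\<dots> = (\<Sum>y\<in>T. q y * worst_payoff u H x y)"
    using assms(2) by (intro sum.cong) (auto simp: w)
  finally show ?thesis .
qed

text \<open>A minimum of linear functions is concave: the payoff vector \<open>U\<close> that is
  worst for the average bounds the worst payoff of each \<open>x\<close> by
  \<open>x \<bullet> U\<close>.\<close>

lemma worst_payoff_concave:
  assumes "y \<in> mixed_actions" "p \<in> distributions_on S"
  shows "(\<Sum>x\<in>S. p x * worst_payoff u H x y) \<le> worst_payoff u H (\<Sum>x\<in>S. p x *\<^sub>R x) y"
proof -
  let ?x = "\<Sum>x\<in>S. p x *\<^sub>R x"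
  obtain U where U: "U \<in> compatible_payoffs u H y" "worst_payoff u H ?x y = ?x \<bullet> U"
    using worst_payoff_attained[OF assms(1)] by blast
  have "worst_payoff u H x y \<le> x \<bullet> U" for x
    using worst_payoff_attained[OF assms(1), of u H x] U(1) by auto
  then have "(\<Sum>x\<in>S. p x * worst_payoff u H x y) \<le> (\<Sum>x\<in>S. p x * (x \<bullet> U))"
    using assms(2) by (intro sum_mono mult_left_mono) (auto simp: distributions_on_def)
  also have "\<dots> = ?x \<bullet> U"
    by (simp add: inner_sum_left)
  finally show ?thesis
    using U(2) by simp
qed

section \<open>Key actions\<close>

lemma key_actions_subset: "key_actions u H \<subseteq> mixed_actions"
  by (auto simp: key_actions_def)

text \<open>Differences between compatible mixed actions and \<open>y'\<close> are generated by
  moves of mass from an action in the support of \<open>y'\<close> to one of equal signal, so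
  testing these moves suffices. The right-hand side sees \<open>y'\<close> only through its support,
  hence only finitely many normal cones occur.\<close>

lemma normal_cone_eq_support_cone:
  fixes u :: "'a::finite \<Rightarrow> 'b::finite \<Rightarrow> real"
  assumes H: "semi_standard H" and y': "y' \<in> mixed_actions" "signal_vec H y' = signal_vec H y"
  shows "normal_cone (compatible_payoffs u H y) (payoff_vec u y') =
    {z. \<forall>(b, b') \<in> {b. y' $ b \<noteq> 0} \<times> UNIV. signal_vec H (axis b' 1) = signal_vec H (axis b 1) \<longrightarrow>
          (payoff_vec u (axis b' 1) - payoff_vec u (axis b 1)) \<bullet> z \<le> 0}" (is "?N = ?R")
proof (intro set_eqI iffI)
  fix z assume z: "z \<in> ?N"
  have "(payoff_vec u (axis b' 1) - payoff_vec u (axis b 1)) \<bullet> z \<le> 0"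
    if b: "y' $ b \<noteq> 0" and s: "signal_vec H (axis b' 1) = signal_vec H (axis b 1)" for b b'
  proof -
    \<comment> \<open>Moving the whole mass of \<open>b\<close> to \<open>b'\<close> preserves
      nonnegativity and the signal, and shifts the payoff vector by a positive multiple of the
      difference to be tested.\<close>
    define y'' where "y'' = y' + (y' $ b) *\<^sub>R (axis b' 1 - axis b 1)"
    have pos: "0 < y' $ b"
      using b y'(1) by (auto simp: mixed_actions_def less_le)
    have "y'' \<in> mixed_actions"
      using y'(1) by (auto simp: y''_def mixed_actions_def axis_def sum.distrib sum_subtractf
          simp flip: sum_distrib_left)
    moreover have "signal_vec H y'' = signal_vec H y"
      by (simp add: y''_def s y'(2) linear_add[OF linear_signal_vec] linear_diff[OF linear_signal_vec]
          linear_scale[OF linear_signal_vec])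
    ultimately have "z \<bullet> (payoff_vec u y'' - payoff_vec u y') \<le> 0"
      using z by (auto simp: normal_cone_def compatible_payoffs_def)
    then have "y' $ b * ((payoff_vec u (axis b' 1) - payoff_vec u (axis b 1)) \<bullet> z) \<le> 0"
      by (simp add: y''_def linear_add[OF linear_payoff_vec] linear_diff[OF linear_payoff_vec]
          linear_scale[OF linear_payoff_vec] inner_commute)
    then show ?thesis
      using pos by (simp add: mult_le_0_iff)
  qed
  then show "z \<in> ?R" by auto
next
  fix z assume z: "z \<in> ?R"
  define s where "s b = signal_vec H (axis b 1)" for b
  define c where "c b = z \<bullet> payoff_vec u (axis b 1)" for b
  \<comment> \<open>\<open>\<mu> b\<close> is the largest value of \<open>z\<close> among the
    actions with the signal of \<open>b\<close>. Membership in \<open>?R\<close> says that every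
    \<open>b\<close> in the support of \<open>y'\<close> attains it, so \<open>y'\<close> maximizes
    \<open>z\<close> among the compatible mixed actions.\<close>
  define \<mu> where "\<mu> b = Max (c ` {b'. s b' = s b})" for b
  have c_le: "c b \<le> \<mu> b" for b
    unfolding \<mu>_def by (intro Max_ge) auto
  have c_eq: "c b = \<mu> b" if "y' $ b \<noteq> 0" for b
    unfolding \<mu>_def using z that
    by (intro Max_eqI[symmetric]) (auto simp: c_def s_def inner_commute algebra_simps)
  have "z \<bullet> (payoff_vec u y'' - payoff_vec u y') \<le> 0"
    if "y'' \<in> mixed_actions" "signal_vec H y'' = signal_vec H y" for y''
  proof -
    have "z \<bullet> payoff_vec u y'' \<le> (\<Sum>b\<in>UNIV. y'' $ b * \<mu> b)"
      unfolding inner_payoff_vec[of z u y''] c_def[symmetric] using that(1) c_le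
      by (intro sum_mono mult_left_mono) (auto simp: mixed_actions_def)
    also have "\<dots> = (\<Sum>b\<in>UNIV. y' $ b * \<mu> b)"
      using that(2) y'(2) by (intro semi_standard_sum_eq[OF H]) (auto simp: \<mu>_def s_def)
    also have "\<dots> = z \<bullet> payoff_vec u y'"
      unfolding inner_payoff_vec[of z u y'] c_def[symmetric] using c_eq
      by (intro sum.cong) (auto simp del: mult_cancel_left)
    finally show ?thesis by (simp add: inner_diff_right)
  qed
  then show "z \<in> ?N"
    by (auto simp: normal_cone_def compatible_payoffs_def)
qed

lemma polyhedron_uminus_mixed_actions: "polyhedron (uminus ` mixed_actions :: (real ^ 'n) set)"
proof -
  have sum: "(\<chi> i. 1) \<bullet> z = (\<Sum>i\<in>UNIV. z $ i)" for z :: "real ^ 'n"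
    by (simp add: inner_vec_def)
  have "(uminus ` mixed_actions :: (real ^ 'n) set) =
      {z. (\<chi> i. 1) \<bullet> z = - 1} \<inter> (\<Inter>i. {z. axis i 1 \<bullet> z \<le> 0})"
  proof (intro set_eqI iffI)
    fix z :: "real ^ 'n"
    assume "z \<in> {z. (\<chi> i. 1) \<bullet> z = - 1} \<inter> (\<Inter>i. {z. axis i 1 \<bullet> z \<le> 0})"
    then have "- z \<in> mixed_actions"
      by (simp add: mixed_actions_def inner_axis' sum sum_negf)
    then show "z \<in> uminus ` mixed_actions"
      by force
  qed (auto simp: mixed_actions_def inner_axis' sum sum_negf)
  moreover have "polyhedron (\<Inter>i. {z :: real ^ 'n. axis i 1 \<bullet> z \<le> 0})"
    by (intro polyhedron_Inter) (auto intro: polyhedron_halfspace_le)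
  ultimately show ?thesis
    by (simp only: polyhedron_Int polyhedron_hyperplane)
qed

text \<open>Negated key actions are vertices of finitely many polyhedra, one for each possible
  support \<open>B\<close>, and a polyhedron has finitely many vertices.\<close>

lemma finite_key_actions:
  fixes u :: "'a::finite \<Rightarrow> 'b::finite \<Rightarrow> real"
  assumes H: "semi_standard H"
  shows "finite (key_actions u H)"
proof -
  define R where "R = (\<lambda>B :: 'b set. {z. \<forall>(b, b') \<in> B \<times> UNIV.
    signal_vec H (axis b' 1) = signal_vec H (axis b 1) \<longrightarrow>
    (payoff_vec u (axis b' 1) - payoff_vec u (axis b 1)) \<bullet> z \<le> 0})"
  have "polyhedron (R B)" for B
  proof -
    have "R B = (\<Inter>(b, b') \<in> {(b, b') \<in> B \<times> UNIV.
          signal_vec H (axis b' 1) = signal_vec H (axis b 1)}.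
        {z. (payoff_vec u (axis b' 1) - payoff_vec u (axis b 1)) \<bullet> z \<le> 0})"
      by (auto simp: R_def)
    then show ?thesis
      by (auto intro: polyhedron_halfspace_le)
  qed
  then have "finite (\<Union>B. {e. e extreme_point_of (uminus ` mixed_actions \<inter> R B)})"
    by (intro finite_UN_I finite_polyhedron_extreme_points polyhedron_Int
        polyhedron_uminus_mixed_actions) auto
  moreover have "uminus ` key_actions u H \<subseteq>
      (\<Union>B. {e. e extreme_point_of (uminus ` mixed_actions \<inter> R B)})"
  proof
    fix z assume "z \<in> uminus ` key_actions u H"
    then obtain y U where U: "U extreme_point_of compatible_payoffs u H y"
      and z: "z extreme_point_of (uminus ` mixed_actions \<inter> normal_cone (compatible_payoffs u H y) U)"
      by (auto simp: key_actions_def)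
    \<comment> \<open>Any mixed action inducing \<open>U\<close> will do; its support is the index
      of the cone.\<close>
    obtain y' where "y' \<in> mixed_actions" "signal_vec H y' = signal_vec H y" "U = payoff_vec u y'"
      using U by (auto simp: extreme_point_of_def compatible_payoffs_def)
    then have "normal_cone (compatible_payoffs u H y) U = R {b. y' $ b \<noteq> 0}"
      using normal_cone_eq_support_cone[OF H] by (simp add: R_def)
    with z show "z \<in> (\<Union>B. {e. e extreme_point_of (uminus ` mixed_actions \<inter> R B)})"
      by auto
  qed
  ultimately have "finite (uminus ` key_actions u H)"
    by (rule rev_finite_subset)
  then show ?thesis
    by (rule finite_imageD) simp
qed

text \<open>If \<open>- z\<close> lies in the normal cone at \<open>U\<close>, then \<open>U\<close>
  minimizes \<open>z \<bullet> W\<close>, so on that piece of the simplex the worst payoff is the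
  linear map sending \<open>z\<close> to \<open>z \<bullet> U\<close>. The vertices of the piece are
  key actions, and \<open>x\<close> is an average of them.\<close>

lemma worst_payoff_affine_decomposition:
  assumes fin: "finite (key_actions u H)" and x: "x \<in> mixed_actions" and y: "y \<in> mixed_actions"
  obtains p where "p \<in> distributions_on (key_actions u H)"
    and "x = (\<Sum>z\<in>key_actions u H. p z *\<^sub>R z)"
    and "worst_payoff u H x y = (\<Sum>z\<in>key_actions u H. p z * worst_payoff u H z y)"
proof -
  let ?K = "key_actions u H" and ?\<Phi> = "compatible_payoffs u H y"
  define m where "m = worst_payoff u H x y"
  obtain U\<^sub>0 where U\<^sub>0: "U\<^sub>0 \<in> ?\<Phi>" "m = x \<bullet> U\<^sub>0" "\<And>W. W \<in> ?\<Phi> \<Longrightarrow> m \<le> x \<bullet> W"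
    using worst_payoff_attained[OF y, of u H x] unfolding m_def by force
  \<comment> \<open>The minimizers for \<open>x\<close> form a face, and an extreme point of a face
    is extreme in the whole set. Hence the minimum is attained at a vertex \<open>U\<close>, as the
    definition of key actions requires.\<close>
  have face: "(?\<Phi> \<inter> {W. x \<bullet> W = m}) face_of ?\<Phi>"
    using U\<^sub>0(3) by (intro face_of_Int_supporting_hyperplane_ge convex_compatible_payoffs)
  have "compact (?\<Phi> \<inter> {W. x \<bullet> W = m})"
    by (intro compact_Int_closed compact_compatible_payoffs closed_hyperplane)
  moreover have "convex (?\<Phi> \<inter> {W. x \<bullet> W = m})"
    by (intro convex_Int convex_compatible_payoffs convex_hyperplane)
  ultimately obtain U where "U extreme_point_of (?\<Phi> \<inter> {W. x \<bullet> W = m})"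
    using extreme_point_exists_convex U\<^sub>0(1,2) by blast
  then have U: "U extreme_point_of ?\<Phi>" "U \<in> ?\<Phi>" "x \<bullet> U = m"
    using extreme_point_of_face[OF face] by auto
  define Q where "Q = uminus ` mixed_actions \<inter> normal_cone ?\<Phi> U"
  have cone: "normal_cone ?\<Phi> U = (\<Inter>W\<in>?\<Phi>. {z. (W - U) \<bullet> z \<le> 0})"
    by (auto simp: normal_cone_def inner_commute)
  have "compact Q"
    unfolding Q_def cone
    by (intro compact_Int_closed closed_INT compact_negations compact_mixed_actions ballI
        closed_halfspace_le)
  moreover have "convex Q"
    unfolding Q_def cone
    by (intro convex_Int convex_INT convex_negations convex_mixed_actions convex_halfspace_le)
  ultimately have Q: "Q = convex hull {e. e extreme_point_of Q}"
    by (rule Krein_Milman_Minkowski)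
  have "- x \<in> Q"
    using x U U\<^sub>0(3) by (auto simp: Q_def normal_cone_def inner_diff_right)
  then have "x \<in> uminus ` (convex hull {e. e extreme_point_of Q})"
    using Q by force
  then have x_hull: "x \<in> convex hull (uminus ` {e. e extreme_point_of Q})"
    by (simp only: convex_hull_linear_image[OF module_hom_uminus, unfolded linear_def[symmetric]])
  \<comment> \<open>\<open>E\<close> gathers the key actions whose worst payoff is attained at this
    same \<open>U\<close>; its finiteness gives explicit convex weights.\<close>
  define E where "E = {z \<in> ?K. worst_payoff u H z y = z \<bullet> U}"
  have "uminus ` {e. e extreme_point_of Q} \<subseteq> E"
  proof (clarify)
    fix e assume e: "e extreme_point_of Q"
    then have eQ: "e \<in> Q" by (simp add: extreme_point_of_def)
    then have "- e \<in> mixed_actions" by (auto simp: Q_def)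
    then have "- e \<in> ?K"
      using e y U(1) by (auto simp: key_actions_def Q_def)
    moreover have "worst_payoff u H (- e) y = - e \<bullet> U"
      unfolding worst_payoff_def using eQ U(2)
      by (intro cInf_eq_minimum) (auto simp: Q_def normal_cone_def inner_diff_right)
    ultimately show "- e \<in> E" by (simp add: E_def)
  qed
  then have "x \<in> convex hull E"
    using x_hull hull_mono by blast
  moreover have "finite E"
    using fin by (simp add: E_def)
  ultimately obtain w where w: "\<And>z. z \<in> E \<Longrightarrow> 0 \<le> w z" "sum w E = 1" "(\<Sum>z\<in>E. w z *\<^sub>R z) = x"
    by (auto simp: convex_hull_finite)
  \<comment> \<open>The weights are extended by 0 from \<open>E\<close> to all key actions.\<close>
  define p where "p = (\<lambda>z. if z \<in> E then w z else 0)"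
  have EK: "E \<subseteq> ?K" by (auto simp: E_def)
  have "sum p ?K = sum w E"
    using EK fin by (intro sum.mono_neutral_cong_right) (auto simp: p_def)
  moreover have "(\<Sum>z\<in>?K. p z *\<^sub>R z) = (\<Sum>z\<in>E. w z *\<^sub>R z)"
    using EK fin by (intro sum.mono_neutral_cong_right) (auto simp: p_def)
  moreover have "(\<Sum>z\<in>?K. p z * worst_payoff u H z y) = (\<Sum>z\<in>E. w z * (z \<bullet> U))"
    using EK fin by (intro sum.mono_neutral_cong_right) (auto simp: p_def E_def)
  moreover have "(\<Sum>z\<in>E. w z * (z \<bullet> U)) = x \<bullet> U"
    by (simp add: inner_sum_left flip: w(3))
  ultimately show thesis
    using w U(3) by (intro that[of p]) (auto simp: distributions_on_def p_def m_def)
qed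

section \<open>Best responses in the two games\<close>

text \<open>The value of any competitor is a mean of key values by affine decomposition; this is at
  most the mean under \<open>p\<close>, which concavity bounds by the value of the average.\<close>

lemma is_arg_max_worst_payoff_average:
  assumes fin: "finite (key_actions u H)" and y: "y \<in> mixed_actions"
    and p: "is_arg_max (\<lambda>p. \<Sum>x\<in>key_actions u H. p x * worst_payoff u H x y)
      (\<lambda>p. p \<in> distributions_on (key_actions u H)) p"
  shows "is_arg_max (\<lambda>x. worst_payoff u H x y) (\<lambda>x. x \<in> mixed_actions)
    (\<Sum>x\<in>key_actions u H. p x *\<^sub>R x)"
  unfolding is_arg_max_linorder
proof (intro conjI allI impI)
  have pK: "p \<in> distributions_on (key_actions u H)"
    using p by (simp add: is_arg_max_linorder)
  then show "(\<Sum>x\<in>key_actions u H. p x *\<^sub>R x) \<in> mixed_actions"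
    using key_actions_subset by (intro mixed_actions_sum) (auto simp: distributions_on_def)
  fix x :: "real ^ 'a" assume "x \<in> mixed_actions"
  then obtain p' where p': "p' \<in> distributions_on (key_actions u H)"
    "worst_payoff u H x y = (\<Sum>z\<in>key_actions u H. p' z * worst_payoff u H z y)"
    using worst_payoff_affine_decomposition[OF fin _ y] by metis
  then have "worst_payoff u H x y \<le> (\<Sum>z\<in>key_actions u H. p z * worst_payoff u H z y)"
    using p by (simp add: is_arg_max_linorder)
  also have "\<dots> \<le> worst_payoff u H (\<Sum>x\<in>key_actions u H. p x *\<^sub>R x) y"
    by (rule worst_payoff_concave[OF y pK])
  finally show "worst_payoff u H x y \<le> worst_payoff u H (\<Sum>x\<in>key_actions u H. p x *\<^sub>R x) y" .
qed

text \<open>The affine decomposition of a maximizer gives weights whose mean equals the maximum, and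
  no mean of worst payoffs exceeds it.\<close>

lemma is_arg_max_worst_payoff_decomposition:
  assumes fin: "finite (key_actions u H)" and y: "y \<in> mixed_actions"
    and x: "is_arg_max (\<lambda>x. worst_payoff u H x y) (\<lambda>x. x \<in> mixed_actions) x"
  obtains p where "is_arg_max (\<lambda>p. \<Sum>x\<in>key_actions u H. p x * worst_payoff u H x y)
      (\<lambda>p. p \<in> distributions_on (key_actions u H)) p"
    and "x = (\<Sum>z\<in>key_actions u H. p z *\<^sub>R z)"
proof -
  have mixed: "x \<in> mixed_actions" and max:
    "\<And>x'. x' \<in> mixed_actions \<Longrightarrow> worst_payoff u H x' y \<le> worst_payoff u H x y"
    using x by (auto simp: is_arg_max_linorder)
  obtain p where p: "p \<in> distributions_on (key_actions u H)"
    "x = (\<Sum>z\<in>key_actions u H. p z *\<^sub>R z)"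
    "worst_payoff u H x y = (\<Sum>z\<in>key_actions u H. p z * worst_payoff u H z y)"
    by (rule worst_payoff_affine_decomposition[OF fin mixed y])
  have "(\<Sum>z\<in>key_actions u H. p' z * worst_payoff u H z y) \<le> worst_payoff u H x y"
    if p': "p' \<in> distributions_on (key_actions u H)" for p'
  proof -
    have "(\<Sum>z\<in>key_actions u H. p' z * worst_payoff u H z y)
        \<le> (\<Sum>z\<in>key_actions u H. p' z * worst_payoff u H x y)"
      using p' max key_actions_subset[of u H]
      by (intro sum_mono mult_left_mono) (auto simp: distributions_on_def)
    also have "\<dots> = worst_payoff u H x y"
      using p' by (simp add: distributions_on_def flip: sum_distrib_right)
    finally show ?thesis .
  qed
  then show thesis
    using p by (intro that[of p]) (auto simp: is_arg_max_linorder)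
qed

text \<open>Linearity in the opponent's action turns each equilibrium condition into a one-player
  maximization against the opponent's average, the form used by the two best-response
  lemmas.\<close>

lemma aux_nash_iff:
  fixes u v :: "'a::finite \<Rightarrow> 'b::finite \<Rightarrow> real"
  assumes H: "semi_standard H" and M: "semi_standard (swap_args M)"
  defines "K \<equiv> key_actions u H" and "L \<equiv> key_actions (swap_args v) (swap_args M)"
  shows "aux_nash u v H M p q \<longleftrightarrow>
    is_arg_max (\<lambda>p. \<Sum>x\<in>K. p x * worst_payoff u H x (\<Sum>y\<in>L. q y *\<^sub>R y))
      (\<lambda>p. p \<in> distributions_on K) p \<and>
    is_arg_max (\<lambda>q. \<Sum>y\<in>L. q y * worst_payoff (swap_args v) (swap_args M) y (\<Sum>x\<in>K. p x *\<^sub>R x))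
      (\<lambda>q. q \<in> distributions_on L) q"
proof -
  have 1: "expected_payoff K L (worst_payoff u H) p' q =
      (\<Sum>x\<in>K. p' x * worst_payoff u H x (\<Sum>y\<in>L. q y *\<^sub>R y))"
    if "q \<in> distributions_on L" for p'
    using worst_payoff_sum_right[OF H _ that, of u] key_actions_subset[of "swap_args v" "swap_args M"]
    by (simp add: expected_payoff_def L_def sum_distrib_left mult.assoc)
  have 2: "expected_payoff K L (\<lambda>x y. worst_payoff (swap_args v) (swap_args M) y x) p q' =
      (\<Sum>y\<in>L. q' y * worst_payoff (swap_args v) (swap_args M) y (\<Sum>x\<in>K. p x *\<^sub>R x))"
    if "p \<in> distributions_on K" for q'
    unfolding expected_payoff_def
    using worst_payoff_sum_right[OF M _ that, of "swap_args v"] key_actions_subset[of u H]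
    by (subst sum.swap) (simp add: K_def sum_distrib_left mult.assoc mult.left_commute)
  \<comment> \<open>The identities \<open>1\<close> and \<open>2\<close> require the opponent's
    weights to be a distribution; each of the two conjuncts supplies this for the other.\<close>
  show ?thesis
    unfolding aux_nash_def mixed_nash_def K_def[symmetric] L_def[symmetric] is_arg_max_linorder
    using 1 2 by auto
qed

theorem theorem2:
  fixes u v :: "'a::finite \<Rightarrow> 'b::finite \<Rightarrow> real"
    and H :: "'a \<Rightarrow> 'b \<Rightarrow> 'h::{real_vector, topological_space}"
    and M :: "'a \<Rightarrow> 'b \<Rightarrow> 'm::{real_vector, topological_space}"
    and HS :: "'h set" and MS :: "'m set"
  assumes "convex HS" and "compact HS" and "\<And>a b. H a b \<in> HS"
    and "convex MS" and "compact MS" and "\<And>a b. M a b \<in> MS"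
    and "semi_standard H" and "semi_standard (swap_args M)"
  shows "finite (key_actions u H) \<and> finite (key_actions (swap_args v) (swap_args M)) \<and>
    (\<forall>p q. aux_nash u v H M p q \<longrightarrow>
       pm_nash u v H M
         (\<Sum>x\<in>key_actions u H. p x *\<^sub>R x)
         (\<Sum>y\<in>key_actions (swap_args v) (swap_args M). q y *\<^sub>R y)) \<and>
    (\<forall>x\<^sub>0 y\<^sub>0. pm_nash u v H M x\<^sub>0 y\<^sub>0 \<longrightarrow>
       (\<exists>p q. aux_nash u v H M p q \<and>
          x\<^sub>0 = (\<Sum>x\<in>key_actions u H. p x *\<^sub>R x) \<and>
          y\<^sub>0 = (\<Sum>y\<in>key_actions (swap_args v) (swap_args M). q y *\<^sub>R y)))"
proof -
  let ?v = "swap_args v" and ?M = "swap_args M"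
  let ?K = "key_actions u H" and ?L = "key_actions ?v ?M"
  note aux = aux_nash_iff[OF assms(7,8), of u v]
  have finK: "finite ?K" and finL: "finite ?L"
    using finite_key_actions assms(7,8) by blast+
  have "pm_nash u v H M (\<Sum>x\<in>?K. p x *\<^sub>R x) (\<Sum>y\<in>?L. q y *\<^sub>R y)"
    if "aux_nash u v H M p q" for p q
  proof -
    have "p \<in> distributions_on ?K" "q \<in> distributions_on ?L"
      using that unfolding aux by (auto simp: is_arg_max_linorder)
    then have "(\<Sum>x\<in>?K. p x *\<^sub>R x) \<in> mixed_actions" "(\<Sum>y\<in>?L. q y *\<^sub>R y) \<in> mixed_actions"
      using key_actions_subset
      by (intro mixed_actions_sum; auto simp: distributions_on_def)+
    then show ?thesis
      using that finK finL unfolding aux pm_nash_def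
      by (intro conjI is_arg_max_worst_payoff_average) auto
  qed
  moreover have "\<exists>p q. aux_nash u v H M p q \<and> x = (\<Sum>x\<in>?K. p x *\<^sub>R x) \<and> y = (\<Sum>y\<in>?L. q y *\<^sub>R y)"
    if "pm_nash u v H M x y" for x y
  proof -
    have x: "is_arg_max (\<lambda>x. worst_payoff u H x y) (\<lambda>x. x \<in> mixed_actions) x"
      and y: "is_arg_max (\<lambda>y. worst_payoff ?v ?M y x) (\<lambda>y. y \<in> mixed_actions) y"
      using that by (auto simp: pm_nash_def)
    then have mixed: "x \<in> mixed_actions" "y \<in> mixed_actions"
      by (auto simp: is_arg_max_linorder)
    \<comment> \<open>\<open>p\<close> is chosen against \<open>y\<close> itself and
      \<open>q\<close> against \<open>x\<close> itself. Since \<open>p\<close> and \<open>q\<close>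
      average exactly to \<open>x\<close> and \<open>y\<close>, these independent choices satisfy
      both conditions of \<open>aux\<close>.\<close>
    obtain p where "is_arg_max (\<lambda>p. \<Sum>x\<in>?K. p x * worst_payoff u H x y)
        (\<lambda>p. p \<in> distributions_on ?K) p" "x = (\<Sum>z\<in>?K. p z *\<^sub>R z)"
      by (rule is_arg_max_worst_payoff_decomposition[OF finK mixed(2) x])
    moreover obtain q where "is_arg_max (\<lambda>q. \<Sum>y\<in>?L. q y * worst_payoff ?v ?M y x)
        (\<lambda>q. q \<in> distributions_on ?L) q" "y = (\<Sum>z\<in>?L. q z *\<^sub>R z)"
      by (rule is_arg_max_worst_payoff_decomposition[OF finL mixed(1) y])
    ultimately show ?thesis
      unfolding aux by blast
  qed
  ultimately show ?thesis
    using finK finL by blast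
qed

end
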